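(* For every integer $k\ge 0$ and every real $x>0$, $$(-1)^{k+1}\left[\varsigma^{(k+1)}(0,x)-\varsigma^{(k+1)}(0)\right]=\log^{k+1}x+\sum_{n=0}^{\infty}\left[\log^{k+1}(n+1+x)-\log^{k+1}(n+1)-x\left[\log^{k+1}(n+2)-\log^{k+1}(n+1)\right]\right],$$ or, equivalently, after re-indexing, $$(-1)^{k+1}\left[\varsigma^{(k+1)}(0,x)-\varsigma^{(k+1)}(0)\right]=\log^{k+1}x+\sum_{n=1}^{\infty}\left[\log^{k+1}(n+x)-\log^{k+1}n-x\left[\log^{k+1}(n+1)-\log^{k+1}n\right]\right].$$
   Context: For $x>0$ the Hurwitz zeta function is $\varsigma(s,x)=\sum_{m=0}^{\infty}\frac{1}{(m+x)^s}$ for $\operatorname{Re} s>1$, analytically continued in $s$ to the whole complex plane except for a simple pole at $s=1$. The Riemann zeta function is $\varsigma(s)=\varsigma(s,1)$. The notation $\varsigma^{(m)}(0,x)$ denotes the $m$-th partial derivative $\frac{\partial^m}{\partial s^m}\varsigma(s,x)$ evaluated at $s=0$, and $\varsigma^{(m)}(0)=\varsigma^{(m)}(0,1)$. The notation $\log^m y$ means $(\log y)^m$ with the natural logarithm. Infinite series are understood as limits of their partial sums. *)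

theory Defs
  imports "HOL-Complex_Analysis.Complex_Analysis"
begin

(* By the identity theorem the continuation is determined on the complement of 1; the
   condition f 1 = 0 only fixes a conventional value at the pole, so that f is unique as
   a total function.  The base of the powers is a positive real, on which the principal
   branch used by powr is the usual real logarithm. *)
definition is_hurwitz_continuation :: "real \<Rightarrow> (complex \<Rightarrow> complex) \<Rightarrow> bool" where
  "is_hurwitz_continuation x f \<longleftrightarrow>
     f holomorphic_on (- {1}) \<and>
     (\<forall>s. Re s > 1 \<longrightarrow> (\<lambda>m. 1 / complex_of_real (real m + x) powr s) sums f s) \<and>
     f 1 = 0"

definition hurwitz_zeta :: "complex \<Rightarrow> real \<Rightarrow> complex" where
  "hurwitz_zeta s x = (THE f. is_hurwitz_continuation x f) s"

definition riemann_zeta :: "complex \<Rightarrow> complex" where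
  "riemann_zeta s = hurwitz_zeta s 1"

lemma is_hurwitz_continuation_unique:
  assumes "is_hurwitz_continuation x f" "is_hurwitz_continuation x g"
  shows "f = g"
proof
  fix s :: complex
  show "f s = g s"
  proof (cases "s = 1")
    case True
    then show ?thesis using assms by (simp add: is_hurwitz_continuation_def)
  next
    case False
    have "f s - g s = 0"
    proof (rule analytic_continuation_open[of "{s. Re s > 1}" "- {1}" "\<lambda>s. f s - g s" "\<lambda>_. 0"])
      show "open {s. Re s > 1}" by (rule open_halfspace_Re_gt)
      have "(2 :: complex) \<in> {s. Re s > 1}" by simp
      then show "{s. Re s > 1} \<noteq> {}" by blast
      show "connected (- {1 :: complex})"
        using connected_punctured_universe[of "1 :: complex"] by simp
      show "f z - g z = 0" if "z \<in> {s. Re s > 1}" for z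
        using that assms sums_unique2 unfolding is_hurwitz_continuation_def by fastforce
    qed (use False assms in \<open>auto simp: is_hurwitz_continuation_def intro!: holomorphic_intros\<close>)
    then show ?thesis by simp
  qed
qed

lemma hurwitz_zeta_eqI:
  assumes "is_hurwitz_continuation x f"
  shows "hurwitz_zeta s x = f s"
proof -
  have "(THE f. is_hurwitz_continuation x f) = f"
    using assms is_hurwitz_continuation_unique by blast
  then show ?thesis by (simp add: hurwitz_zeta_def)
qed

end

theory Submission
  imports Defs
begin

text \<open>
  Put \<open>g\<^sub>n(s) = (n+1+x)\<^sup>-\<^sup>s - (n+1)\<^sup>-\<^sup>s - x ((n+2)\<^sup>-\<^sup>s - (n+1)\<^sup>-\<^sup>s)\<close>.  For \<open>Re s > 1\<close> the series
  \<open>\<Sum> g\<^sub>n(s)\<close> can be summed in pieces: the first two powers give the Hurwitz and the Riemann zeta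
  function (the former without its first term \<open>x\<^sup>-\<^sup>s\<close>) and the last bracket telescopes to \<open>-1\<close>, so
  \<open>\<Sum> g\<^sub>n(s) = \<zeta>(s,x) - x\<^sup>-\<^sup>s - \<zeta>(s) + x\<close>.  The correction by \<open>x\<close> times a first difference
  cancels the leading term of \<open>(n+1+x)\<^sup>-\<^sup>s - (n+1)\<^sup>-\<^sup>s\<close>, so \<open>g\<^sub>n(s)\<close> is at most of the
  order of \<open>n\<close> to the power \<open>-2 - Re s\<close> (\<open>zeta_difference_term_bound\<close>), and the series
  converges locally uniformly even for \<open>Re s > -1\<close>.  By analytic continuation the identity holds
  in this half-plane apart from the point \<open>1\<close>, in particular near \<open>0\<close>; there it may be
  differentiated term by term any number of times.  An \<open>m\<close>-th derivative of \<open>y\<^sup>-\<^sup>s\<close> at \<open>0\<close> is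
  \<open>(-log y)\<^sup>m\<close>, and the constant \<open>x\<close> disappears because at least one derivative is taken
  (\<open>hurwitz_zeta_minus_riemann_zeta\<close>, \<open>higher_deriv_zeta_difference_sums\<close>).

  The argument needs the continuation of \<open>\<zeta>(s,x)\<close> to exist, since \<open>hurwitz_zeta\<close> is a definite
  description.  Expanding the telescoping series \<open>\<Sum> ((m+1+x)\<^sup>1\<^sup>-\<^sup>s - (m+x)\<^sup>1\<^sup>-\<^sup>s) = -x\<^sup>1\<^sup>-\<^sup>s\<close> by the
  binomial series in \<open>1/(m+x)\<close> expresses \<open>(s-1) \<zeta>(s,x)\<close> through the values \<open>\<zeta>(s+i,x)\<close> with
  \<open>1 \<le> i \<le> n\<close> and a remainder series that converges for \<open>Re s > -n\<close>
  (\<open>hurwitz_series_shift_recursion\<close>).  This extends \<open>(s-1) \<zeta>(s,x)\<close> holomorphically to the left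
  by one unit at a time (\<open>hurwitz_series_continuation_half_plane\<close>).

  The holomorphy of all the series rests on one M-test (\<open>half_plane_dominated_series\<close>), and both kinds of
  remainder on one uniform bound for the binomial series (\<open>binomial_remainder_bound\<close>).
\<close>

section \<open>Series of holomorphic functions on a half-plane\<close>

lemma summable_shifted_powr:
  fixes y a :: real
  assumes "y > 0" "a < -1"
  shows "summable (\<lambda>n. (real n + y) powr a)"
proof (rule summable_comparison_test_ev)
  show "summable (\<lambda>n. real n powr a)"
    using assms(2) by (simp add: summable_real_powr_iff)
  show "\<forall>\<^sub>F n in sequentially. norm ((real n + y) powr a) \<le> real n powr a"
    using eventually_gt_at_top[of 0]
    by eventually_elim (use assms in \<open>auto intro: powr_mono2'\<close>)
qed

text \<open>
  The exponent \<open>c - 1 - Re s\<close> is exactly what makes the majorant summable when \<open>Re s > c\<close>.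
  The constant may depend on a bound for \<open>norm s\<close>, as it does for binomial remainders, because only
  small discs are considered.
\<close>
lemma half_plane_dominated_series:
  fixes f :: "nat \<Rightarrow> complex \<Rightarrow> complex" and c y :: real
  assumes y: "y > 0"
    and bound: "\<And>R. \<exists>C. \<forall>\<^sub>F n in sequentially. \<forall>s. norm s \<le> R \<longrightarrow>
                  norm (f n s) \<le> C * (real n + y) powr (c - 1 - Re s)"
    and z: "Re z > c"
  shows "\<exists>d>0. cball z d \<subseteq> {s. Re s > c} \<and>
           uniform_limit (cball z d) (\<lambda>N s. \<Sum>n<N. f n s) (\<lambda>s. \<Sum>n. f n s) sequentially"
proof -
  \<comment> \<open>On the disc of half the distance to the boundary line, the real part exceeds \<open>c\<close> by at least \<open>d\<close>.\<close>
  define d where "d = (Re z - c) / 2"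
  have d: "d > 0" using z by (simp add: d_def)
  have Re_ge: "Re s \<ge> c + d" if "s \<in> cball z d" for s
  proof -
    have "Re z - Re s \<le> norm (z - s)"
      using complex_Re_le_cmod[of "z - s"] by simp
    also have "\<dots> \<le> d" using that by (simp add: dist_norm)
    finally show ?thesis by (simp add: d_def field_simps)
  qed
  have norm_le: "norm s \<le> norm z + d" if "s \<in> cball z d" for s
    using that norm_triangle_ineq2[of s z] by (simp add: dist_norm norm_minus_commute)
  obtain C where C: "\<forall>\<^sub>F n in sequentially. \<forall>s. norm s \<le> norm z + d \<longrightarrow>
      norm (f n s) \<le> C * (real n + y) powr (c - 1 - Re s)"
    using bound by blast
  have "uniform_limit (cball z d) (\<lambda>N s. \<Sum>n<N. f n s) (\<lambda>s. \<Sum>n. f n s) sequentially"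
  proof (rule Weierstrass_m_test_ev)
    show "\<forall>\<^sub>F n in sequentially. \<forall>s\<in>cball z d. norm (f n s) \<le> \<bar>C\<bar> * (real n + y) powr (- 1 - d)"
      using C eventually_ge_at_top[of 1]
    proof eventually_elim
      case (elim n)
      show ?case
      proof
        fix s assume s: "s \<in> cball z d"
        have "norm (f n s) \<le> C * (real n + y) powr (c - 1 - Re s)"
          using elim(1) norm_le[OF s] by blast
        also have "\<dots> \<le> \<bar>C\<bar> * (real n + y) powr (c - 1 - Re s)"
          by (intro mult_right_mono) auto
        also have "\<dots> \<le> \<bar>C\<bar> * (real n + y) powr (- 1 - d)"
          using elim(2) y Re_ge[OF s] by (intro mult_left_mono powr_mono) auto
        finally show "norm (f n s) \<le> \<bar>C\<bar> * (real n + y) powr (- 1 - d)" .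
      qed
    qed
    show "summable (\<lambda>n. \<bar>C\<bar> * (real n + y) powr (- 1 - d))"
      using y d by (intro summable_mult summable_shifted_powr) auto
  qed
  moreover have "cball z d \<subseteq> {s. Re s > c}"
    using Re_ge d by fastforce
  ultimately show ?thesis using d by blast
qed

lemma holomorphic_on_half_plane_dominated_series:
  fixes f :: "nat \<Rightarrow> complex \<Rightarrow> complex" and c y :: real
  assumes "y > 0"
    and "\<And>R. \<exists>C. \<forall>\<^sub>F n in sequentially. \<forall>s. norm s \<le> R \<longrightarrow>
           norm (f n s) \<le> C * (real n + y) powr (c - 1 - Re s)"
    and "\<And>n. f n holomorphic_on {s. Re s > c}"
  shows "(\<lambda>s. \<Sum>n. f n s) holomorphic_on {s. Re s > c}"
  by (rule holomorphic_uniform_sequence[where f = "\<lambda>N s. \<Sum>n<N. f n s"])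
     (use half_plane_dominated_series[OF assms(1,2)] in
       \<open>auto intro!: holomorphic_intros open_halfspace_Re_gt assms(3)\<close>)

section \<open>The remainder of the binomial series\<close>

text \<open>
  In the product formula every factor satisfies \<open>norm (a - i) \<le> A + i\<close>; these are the
  absolute values of the factors belonging to the exponent \<open>-A\<close>.
\<close>
lemma norm_gbinomial_le:
  fixes a :: complex
  assumes "norm a \<le> A"
  shows "norm (a gchoose j) \<le> \<bar>(-A) gchoose j\<bar>"
proof -
  have "norm (\<Prod>i<j. a - of_nat i) \<le> (\<Prod>i<j. \<bar>- A - of_nat i\<bar>)"
    unfolding prod_norm[symmetric]
  proof (intro prod_mono conjI)
    fix i
    have "norm (a - of_nat i) \<le> norm a + norm (of_nat i :: complex)"
      by (rule norm_triangle_ineq4)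
    then show "norm (a - of_nat i) \<le> \<bar>- A - of_nat i\<bar>"
      using assms by simp
  qed auto
  then show ?thesis
    by (simp add: gbinomial_prod_rev norm_divide abs_prod divide_right_mono atLeast0LessThan)
qed

text \<open>
  The tail of the binomial series is \<open>w ^ N\<close> times a series that, for \<open>norm w \<le> 1/2\<close>, is dominated
  by a convergent series which depends only on \<open>A\<close> and \<open>N\<close>: its coefficients are those of the
  binomial series with exponent \<open>-A\<close>, evaluated at \<open>1/2\<close>.
\<close>
lemma binomial_remainder_bound:
  fixes A :: real and N :: nat
  obtains C where "\<And>a w :: complex. norm a \<le> A \<Longrightarrow> norm w \<le> 1/2 \<Longrightarrow>
     norm ((1 + w) powr a - (\<Sum>j<N. (a gchoose j) * w ^ j)) \<le> C * norm w ^ N"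
proof
  define c where "c j = \<bar>(-A) gchoose j\<bar>" for j :: nat
  define C where "C = (\<Sum>i. c (i + N) * (1/2) ^ i)"
  have "summable (\<lambda>j. norm (((-A) gchoose j) * (1/2) ^ j))"
    by (rule abs_summable_in_conv_radius) (simp add: conv_radius_gchoose)
  then have "summable (\<lambda>j. c j * (1/2) ^ j)"
    by (simp add: c_def abs_mult power_abs)
  then have "summable (\<lambda>i. c (i + N) * (1/2) ^ (i + N))"
    by (rule summable_ignore_initial_segment)
  then have "summable (\<lambda>i. 2 ^ N * (c (i + N) * (1/2) ^ (i + N)))"
    by (rule summable_mult)
  then have sum_c: "summable (\<lambda>i. c (i + N) * (1/2) ^ i)"
    by (simp add: power_add power_one_over field_simps)
  fix a w :: complex
  assume a: "norm a \<le> A" and w: "norm w \<le> 1/2"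
  have "(\<lambda>j. (a gchoose j) * w ^ j) sums (1 + w) powr a"
    using w by (intro gen_binomial_complex) auto
  then have tail: "(\<lambda>i. (a gchoose (i + N)) * w ^ (i + N)) sums
      ((1 + w) powr a - (\<Sum>j<N. (a gchoose j) * w ^ j))"
    by (rule sums_split_initial_segment)
  have le: "norm ((a gchoose (i + N)) * w ^ (i + N)) \<le> norm w ^ N * (c (i + N) * (1/2) ^ i)" for i
  proof -
    have "norm ((a gchoose (i + N)) * w ^ (i + N)) \<le> c (i + N) * ((1/2) ^ i * norm w ^ N)"
      unfolding norm_mult norm_power power_add c_def
      by (intro mult_mono norm_gbinomial_le a power_mono w) auto
    then show ?thesis by (simp add: mult_ac)
  qed
  have "norm (\<Sum>i. (a gchoose (i + N)) * w ^ (i + N)) \<le> (\<Sum>i. norm w ^ N * (c (i + N) * (1/2) ^ i))"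
    using le by (intro norm_suminf_le summable_mult sum_c)
  also have "\<dots> = C * norm w ^ N"
    using sum_c by (simp add: C_def suminf_mult)
  finally show "norm ((1 + w) powr a - (\<Sum>j<N. (a gchoose j) * w ^ j)) \<le> C * norm w ^ N"
    using tail by (simp add: sums_unique[symmetric])
qed

section \<open>The Hurwitz series and its shift recursion\<close>

lemma norm_of_real_powr:
  "y > 0 \<Longrightarrow> norm (complex_of_real y powr a) = y powr Re a"
  by (simp add: norm_powr_real_powr)

lemma of_real_add_powr:
  fixes y t :: real
  assumes "y > 0" "t \<ge> 0"
  shows "complex_of_real (y + t) powr a = of_real y powr a * (1 + of_real (t / y)) powr a"
proof -
  have "complex_of_real (y + t) = of_real y * of_real (1 + t / y)"
    using assms by (simp add: field_simps flip: of_real_mult)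
  then show ?thesis
    using assms by (simp add: powr_times_real_left)
qed

lemma holomorphic_on_gbinomial [holomorphic_intros]:
  assumes "f holomorphic_on A"
  shows "(\<lambda>s. f s gchoose k) holomorphic_on A"
  unfolding gbinomial_prod_rev using assms by (auto intro!: holomorphic_intros)

lemma holomorphic_on_of_real_powr [holomorphic_intros]:
  assumes "f holomorphic_on A" "y > 0"
  shows "(\<lambda>s. complex_of_real y powr f s) holomorphic_on A"
  using assms by (intro holomorphic_intros) auto

lemma summable_shifted_complex_powr:
  fixes y :: real
  assumes "y > 0" "Re s > 1"
  shows "summable (\<lambda>m. complex_of_real (real m + y) powr (- s))"
proof (rule summable_norm_cancel)
  show "summable (\<lambda>m. norm (complex_of_real (real m + y) powr (- s)))"
    using summable_shifted_powr[of y "- Re s"] assms by (simp add: norm_of_real_powr del: of_real_add)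
qed

lemma shifted_powr_tendsto_0:
  fixes y :: real
  assumes "Re a < 0"
  shows "(\<lambda>m. complex_of_real (real m + y) powr a) \<longlonglongrightarrow> 0"
  using assms
  by (intro tendsto_neg_powr_complex_of_real)
     (auto intro: filterlim_tendsto_add_at_top[OF tendsto_const] filterlim_real_sequentially
           simp: add.commute[of _ y])

definition hurwitz_series :: "real \<Rightarrow> complex \<Rightarrow> complex" where
  "hurwitz_series x s = (\<Sum>m. complex_of_real (real m + x) powr (- s))"

lemma hurwitz_series_sums:
  "x > 0 \<Longrightarrow> Re s > 1 \<Longrightarrow> (\<lambda>m. complex_of_real (real m + x) powr (- s)) sums hurwitz_series x s"
  unfolding hurwitz_series_def by (intro summable_sums summable_shifted_complex_powr)

lemma holomorphic_on_hurwitz_series: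
  assumes "x > 0"
  shows "hurwitz_series x holomorphic_on {s. Re s > 1}"
  unfolding hurwitz_series_def[abs_def]
proof (rule holomorphic_on_half_plane_dominated_series[OF assms])
  show "\<exists>C. \<forall>\<^sub>F m in sequentially. \<forall>s. norm s \<le> R \<longrightarrow>
      norm (complex_of_real (real m + x) powr (- s)) \<le> C * (real m + x) powr (1 - 1 - Re s)" for R
    using assms by (intro exI[of _ 1]) (simp add: norm_of_real_powr del: of_real_add)
  show "(\<lambda>s. complex_of_real (real m + x) powr (- s)) holomorphic_on {s. Re s > 1}" for m
    using assms by (intro holomorphic_intros) auto
qed

text \<open>
  With \<open>w = 1/(m+x)\<close> the expression is \<open>(m+x)\<^sup>1\<^sup>-\<^sup>s\<close> times the remainder of order \<open>n+2\<close> of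
  \<open>(1+w)\<^sup>1\<^sup>-\<^sup>s\<close>, which adds \<open>-(n+2)\<close> to the exponent \<open>1 - Re s\<close>.
\<close>
lemma shift_recursion_remainder_bound:
  fixes x :: real and n :: nat
  assumes x: "x > 0"
  shows "\<exists>C. \<forall>\<^sub>F m in sequentially. \<forall>s. norm s \<le> R \<longrightarrow>
     norm (complex_of_real (real (Suc m) + x) powr (1 - s) -
           (\<Sum>j<n+2. ((1 - s) gchoose j) * complex_of_real (real m + x) powr (1 - s - of_nat j)))
       \<le> C * (real m + x) powr (- real n - 1 - Re s)"
proof -
  obtain C where C: "\<And>a w :: complex. norm a \<le> 1 + R \<Longrightarrow> norm w \<le> 1/2 \<Longrightarrow>
     norm ((1 + w) powr a - (\<Sum>j<n+2. (a gchoose j) * w ^ j)) \<le> C * norm w ^ (n + 2)"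
    using binomial_remainder_bound[of "1 + R" "n + 2"] by blast
  have "\<forall>\<^sub>F m in sequentially. \<forall>s. norm s \<le> R \<longrightarrow>
     norm (complex_of_real (real (Suc m) + x) powr (1 - s) -
           (\<Sum>j<n+2. ((1 - s) gchoose j) * complex_of_real (real m + x) powr (1 - s - of_nat j)))
       \<le> C * (real m + x) powr (- real n - 1 - Re s)"
    \<comment> \<open>From \<open>m = 2\<close> on, \<open>1/(m+x) \<le> 1/2\<close>, as the binomial estimate requires.\<close>
    using eventually_ge_at_top[of 2]
  proof (eventually_elim, intro allI impI)
    fix m :: nat and s :: complex
    assume m: "m \<ge> 2" and s: "norm s \<le> R"
    define y where "y = real m + x"
    define w where "w = complex_of_real (1 / y)"
    have y: "y \<ge> 2" using m x by (simp add: y_def)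
    have norm_w: "norm w = 1 / y" using y by (simp add: w_def norm_divide)
    have power: "complex_of_real y powr (1 - s - of_nat j) = of_real y powr (1 - s) * w ^ j" for j
      using y by (simp add: powr_diff w_def power_divide)
    have Suc: "complex_of_real (y + 1) powr (1 - s) = of_real y powr (1 - s) * (1 + w) powr (1 - s)"
      using of_real_add_powr[of y 1] y by (simp add: w_def)
    have "norm (complex_of_real (y + 1) powr (1 - s) -
             (\<Sum>j<n+2. ((1 - s) gchoose j) * complex_of_real y powr (1 - s - of_nat j)))
        = norm (complex_of_real y powr (1 - s)) *
            norm ((1 + w) powr (1 - s) - (\<Sum>j<n+2. ((1 - s) gchoose j) * w ^ j))"
      unfolding power Suc norm_mult[symmetric] by (simp only: right_diff_distrib sum_distrib_left mult_ac)
    also have "\<dots> \<le> y powr (1 - Re s) * (C * norm w ^ (n + 2))"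
      using y s norm_triangle_ineq4[of 1 s] norm_w
      by (intro mult_mono C) (auto simp: norm_of_real_powr intro!: order.trans[OF norm_triangle_ineq4])
    also have "norm w ^ (n + 2) = y powr (- real (n + 2))"
      using y unfolding powr_minus by (subst powr_realpow) (auto simp: norm_w power_one_over inverse_eq_divide)
    also have "y powr (1 - Re s) * (C * y powr (- real (n + 2)))
        = C * (y powr (1 - Re s) * y powr (- real (n + 2)))"
      by simp
    also have "y powr (1 - Re s) * y powr (- real (n + 2)) = y powr (- real n - 1 - Re s)"
      unfolding powr_add[symmetric] by (rule arg_cong[where f = "(powr) y"]) simp
    finally show "norm (complex_of_real (real (Suc m) + x) powr (1 - s) -
           (\<Sum>j<n+2. ((1 - s) gchoose j) * complex_of_real (real m + x) powr (1 - s - of_nat j)))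
       \<le> C * (real m + x) powr (- real n - 1 - Re s)"
      by (simp only: y_def of_nat_Suc add_ac)
  qed
  then show ?thesis by blast
qed

text \<open>
  Summing the binomial expansion of \<open>(m+1+x)\<^sup>1\<^sup>-\<^sup>s\<close> over \<open>m\<close>, the term \<open>j = 0\<close> telescopes, the term
  \<open>j = 1\<close> produces \<open>(1-s) \<zeta>(s,x)\<close>, and the term \<open>j = i+2\<close> produces a multiple of \<open>\<zeta>(s+i+1,x)\<close>.
  The coefficient of the latter contains the factor \<open>s+i\<close>, which is kept next to \<open>\<zeta>(s+i+1,x)\<close>
  because it cancels the pole of that function at \<open>s = -i\<close>: the recursion thereby only involves
  the entire function \<open>(s-1) \<zeta>(s,x)\<close>.
\<close>
lemma hurwitz_series_shift_recursion:
  fixes x :: real and n :: nat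
  assumes x: "x > 0" and s: "Re s > 1"
  shows "(s - 1) * hurwitz_series x s = complex_of_real x powr (1 - s)
     + (\<Sum>m. complex_of_real (real (Suc m) + x) powr (1 - s) -
           (\<Sum>j<n+2. ((1 - s) gchoose j) * complex_of_real (real m + x) powr (1 - s - of_nat j)))
     - (\<Sum>i<n. ((1 - s) gchoose (Suc i)) / of_nat (i + 2)
              * ((s + of_nat (Suc i) - 1) * hurwitz_series x (s + of_nat (Suc i))))"
proof -
  define Z where "Z = hurwitz_series x"
  have telescope: "(\<lambda>m. complex_of_real (real (Suc m) + x) powr (1 - s)
      - complex_of_real (real m + x) powr (1 - s)) sums (0 - complex_of_real (real 0 + x) powr (1 - s))"
    using s by (intro telescope_sums shifted_powr_tendsto_0) auto
  have Z: "(\<lambda>m. complex_of_real (real m + x) powr (1 - s - of_nat (Suc j))) sums Z (s + of_nat j)" for j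
  proof -
    have "- (s + of_nat j) = 1 - s - of_nat (Suc j)" by simp
    then show ?thesis
      using hurwitz_series_sums[of x "s + of_nat j"] x s unfolding Z_def by simp
  qed
  have "(\<lambda>m. (complex_of_real (real (Suc m) + x) powr (1 - s)
        - complex_of_real (real m + x) powr (1 - s))
      - (\<Sum>j<n+1. ((1 - s) gchoose (Suc j)) * complex_of_real (real m + x) powr (1 - s - of_nat (Suc j))))
      sums ((0 - complex_of_real (real 0 + x) powr (1 - s))
             - (\<Sum>j<n+1. ((1 - s) gchoose (Suc j)) * Z (s + of_nat j)))"
    by (intro sums_diff telescope sums_sum sums_mult Z)
  then have "(\<lambda>m. complex_of_real (real (Suc m) + x) powr (1 - s)
      - (\<Sum>j<n+2. ((1 - s) gchoose j) * complex_of_real (real m + x) powr (1 - s - of_nat j)))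
      sums (- (complex_of_real x powr (1 - s)) - (\<Sum>j<n+1. ((1 - s) gchoose (Suc j)) * Z (s + of_nat j)))"
    by (simp add: sum.lessThan_Suc_shift diff_diff_eq del: sum.lessThan_Suc of_nat_Suc)
  note series = sums_unique[OF this, symmetric]
  have coeff: "((1 - s) gchoose (Suc (Suc i)))
      = - (((1 - s) gchoose (Suc i)) / of_nat (i + 2) * (s + of_nat (Suc i) - 1))" for i
  proof -
    have "of_nat (i + 2) * ((1 - s) gchoose (Suc (Suc i)))
        = (1 - s - of_nat (Suc i)) * ((1 - s) gchoose (Suc i))"
      using gbinomial_mult_1[of "1 - s" "Suc i"]
      unfolding add_2_eq_Suc' left_diff_distrib by (metis add_diff_cancel_left')
    moreover have "of_nat (i + 2) \<noteq> (0 :: complex)"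
      by (simp only: of_nat_eq_0_iff)
    ultimately have "((1 - s) gchoose (Suc (Suc i)))
        = (1 - s - of_nat (Suc i)) * ((1 - s) gchoose (Suc i)) / of_nat (i + 2)"
      by (metis nonzero_mult_div_cancel_left)
    also have "\<dots> = - (((1 - s) gchoose (Suc i)) / of_nat (i + 2) * (s + of_nat (Suc i) - 1))"
      by (simp add: divide_inverse algebra_simps)
    finally show ?thesis .
  qed
  have "(\<Sum>j<n+1. ((1 - s) gchoose (Suc j)) * Z (s + of_nat j))
     = (1 - s) * Z s + (\<Sum>i<n. ((1 - s) gchoose (Suc (Suc i))) * Z (s + of_nat (Suc i)))"
    by (simp add: sum.lessThan_Suc_shift del: sum.lessThan_Suc of_nat_Suc)
  also have "(\<Sum>i<n. ((1 - s) gchoose (Suc (Suc i))) * Z (s + of_nat (Suc i)))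
     = - (\<Sum>i<n. ((1 - s) gchoose (Suc i)) / of_nat (i + 2)
              * ((s + of_nat (Suc i) - 1) * Z (s + of_nat (Suc i))))"
    unfolding coeff sum_negf[symmetric] by (intro sum.cong refl) (simp only: mult_minus_left mult.assoc)
  finally show ?thesis
    unfolding series Z_def[symmetric] by (simp add: algebra_simps)
qed

section \<open>Analytic continuation of the Hurwitz zeta function\<close>

text \<open>
  The right-hand side of the shift recursion only evaluates the function at \<open>s+1, \<dots>, s+n\<close>, which lie
  in the known half-plane \<open>Re s > 1 - n\<close> as soon as \<open>Re s > -n\<close>; so it serves as the definition of
  the continuation on the next half-plane.
\<close>
lemma hurwitz_series_continuation_half_plane:
  assumes x: "x > 0"
  shows "\<exists>h. h holomorphic_on {s. Re s > 1 - real n} \<and>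
            (\<forall>s. Re s > 1 \<longrightarrow> h s = (s - 1) * hurwitz_series x s)"
proof (induction n)
  case 0
  then show ?case
    using holomorphic_on_hurwitz_series[OF x]
    by (intro exI[of _ "\<lambda>s. (s - 1) * hurwitz_series x s"]) (auto intro!: holomorphic_intros)
next
  case (Suc n)
  then obtain h where hol: "h holomorphic_on {s. Re s > 1 - real n}"
    and h: "\<And>s. Re s > 1 \<Longrightarrow> h s = (s - 1) * hurwitz_series x s" by blast
  define r where "r m s = complex_of_real (real (Suc m) + x) powr (1 - s) -
      (\<Sum>j<n+2. ((1 - s) gchoose j) * complex_of_real (real m + x) powr (1 - s - of_nat j))" for m s
  define h' where "h' s = complex_of_real x powr (1 - s) + (\<Sum>m. r m s)
     - (\<Sum>i<n. ((1 - s) gchoose (Suc i)) / of_nat (i + 2) * h (s + of_nat (Suc i)))" for s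
  have "(\<lambda>s. \<Sum>m. r m s) holomorphic_on {s. Re s > - real n}"
  proof (rule holomorphic_on_half_plane_dominated_series[OF x])
    show "\<exists>C. \<forall>\<^sub>F m in sequentially. \<forall>s. norm s \<le> R \<longrightarrow>
        norm (r m s) \<le> C * (real m + x) powr (- real n - 1 - Re s)" for R
      unfolding r_def by (rule shift_recursion_remainder_bound[OF x])
    show "r m holomorphic_on {s. Re s > - real n}" for m
      unfolding r_def[abs_def] using x by (intro holomorphic_intros) auto
  qed
  moreover have "(\<lambda>s. h (s + of_nat (Suc i))) holomorphic_on {s. Re s > - real n}" for i
  proof -
    have "h \<circ> (\<lambda>s. s + of_nat (Suc i)) holomorphic_on {s. Re s > - real n}"
      by (rule holomorphic_on_compose_gen[OF _ hol]) (auto intro!: holomorphic_intros)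
    then show ?thesis by (simp only: o_def)
  qed
  ultimately have "h' holomorphic_on {s. Re s > - real n}"
    unfolding h'_def[abs_def] using x by (intro holomorphic_intros) auto
  moreover have "h' s = (s - 1) * hurwitz_series x s" if "Re s > 1" for s
  proof -
    have "h (s + of_nat (Suc i)) = (s + of_nat (Suc i) - 1) * hurwitz_series x (s + of_nat (Suc i))" for i
      using that by (intro h) simp
    then show ?thesis
      unfolding hurwitz_series_shift_recursion[OF x that, of n] h'_def r_def by simp
  qed
  ultimately show ?case by auto
qed

text \<open>
  The continuations to the half-planes agree on overlaps by the identity theorem, so they glue to an
  entire function, and division by \<open>s-1\<close> leaves at most the pole at \<open>1\<close>.
\<close>
lemma is_hurwitz_continuation_exists:
  assumes x: "x > 0"
  obtains f where "is_hurwitz_continuation x f"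
proof -
  obtain h where hol: "\<And>n. h n holomorphic_on {s. Re s > 1 - real n}"
    and h: "\<And>n s. Re s > 1 \<Longrightarrow> h n s = (s - 1) * hurwitz_series x s"
    using hurwitz_series_continuation_half_plane[OF x] by metis
  have agree: "h n s = h m s" if "Re s > 1 - real n" "Re s > 1 - real m" for n m s
  proof (rule analytic_continuation_open[of "{s. Re s > 1}" "{s. Re s > max (1 - real n) (1 - real m)}" "h n" "h m"])
    show "open {s. Re s > max (1 - real n) (1 - real m)}" "open {s. Re s > 1}"
      by (rule open_halfspace_Re_gt)+
    show "connected {s. Re s > max (1 - real n) (1 - real m)}"
      by (rule connected_halfspace_Re_gt)
    have "(2 :: complex) \<in> {s. Re s > 1}" by simp
    then show "{s. Re s > 1} \<noteq> {}" by blast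
    show "h n holomorphic_on {s. Re s > max (1 - real n) (1 - real m)}"
         "h m holomorphic_on {s. Re s > max (1 - real n) (1 - real m)}"
      by (auto intro: holomorphic_on_subset[OF hol])
  qed (use that in \<open>auto simp: h\<close>)
  \<comment> \<open>The index is large enough that \<open>s\<close> lies in the chosen half-plane.\<close>
  define H where "H s = h (nat \<lceil>2 - Re s\<rceil>) s" for s
  have H: "H s = h n s" if "Re s > 1 - real n" for n s
    unfolding H_def using that by (intro agree) linarith+
  have "H holomorphic_on (\<Union>n\<in>UNIV. {s. Re s > 1 - real n})"
  proof (rule holomorphic_on_UN_open)
    show "H holomorphic_on {s. Re s > 1 - real n}" for n
      using hol[of n] by (rule holomorphic_transform) (simp add: H)
  qed (simp add: open_halfspace_Re_gt)
  moreover have "s \<in> (\<Union>n\<in>UNIV. {s. Re s > 1 - real n})" for s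
    using reals_Archimedean2[of "1 - Re s"] by (auto simp: algebra_simps)
  ultimately have H_entire: "H holomorphic_on A" for A
    by (meson holomorphic_on_subset subsetI)
  have "is_hurwitz_continuation x (\<lambda>s. if s = 1 then 0 else H s / (s - 1))"
    unfolding is_hurwitz_continuation_def
  proof (intro conjI allI impI)
    have "(\<lambda>s. H s / (s - 1)) holomorphic_on - {1}"
      by (intro holomorphic_intros H_entire) auto
    then show "(\<lambda>s. if s = 1 then 0 else H s / (s - 1)) holomorphic_on - {1}"
      by (rule holomorphic_transform) auto
    fix s :: complex assume s: "Re s > 1"
    have "H s = (s - 1) * hurwitz_series x s"
      using H[of 0 s] h[OF s] s by simp
    moreover have "s \<noteq> 1" using s by auto
    ultimately show "(\<lambda>m. 1 / complex_of_real (real m + x) powr s) sums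
        (if s = 1 then 0 else H s / (s - 1))"
      using hurwitz_series_sums[OF x s] by (simp add: powr_minus_divide)
  qed simp
  then show ?thesis by (rule that)
qed

lemma hurwitz_zeta_continuation:
  assumes "x > 0"
  shows "is_hurwitz_continuation x (\<lambda>s. hurwitz_zeta s x)"
proof -
  obtain f where f: "is_hurwitz_continuation x f"
    using is_hurwitz_continuation_exists[OF assms] .
  then have "(\<lambda>s. hurwitz_zeta s x) = f"
    by (intro ext hurwitz_zeta_eqI)
  with f show ?thesis by simp
qed

lemma hurwitz_zeta_eq_series:
  assumes "x > 0" "Re s > 1"
  shows "hurwitz_zeta s x = hurwitz_series x s"
proof -
  have "(\<lambda>m. 1 / complex_of_real (real m + x) powr s) sums hurwitz_zeta s x"
    using hurwitz_zeta_continuation[OF assms(1)] assms(2) by (simp add: is_hurwitz_continuation_def)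
  then have "(\<lambda>m. complex_of_real (real m + x) powr (- s)) sums hurwitz_zeta s x"
    by (simp add: powr_minus_divide)
  then show ?thesis
    using hurwitz_series_sums[OF assms] sums_unique2 by blast
qed

section \<open>The difference of the Hurwitz and the Riemann zeta function\<close>

definition zeta_difference_term :: "real \<Rightarrow> nat \<Rightarrow> complex \<Rightarrow> complex" where
  "zeta_difference_term x n s =
     complex_of_real (real n + 1 + x) powr (- s) - complex_of_real (real n + 1) powr (- s)
     - of_real x * (complex_of_real (real n + 2) powr (- s) - complex_of_real (real n + 1) powr (- s))"

lemma holomorphic_on_zeta_difference_term [holomorphic_intros]:
  "x > 0 \<Longrightarrow> zeta_difference_term x n holomorphic_on A"
  unfolding zeta_difference_term_def[abs_def] by (intro holomorphic_intros) auto

text \<open>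
  With \<open>y = n+1\<close>, both \<open>(y+x)\<^sup>-\<^sup>s\<close> and \<open>(y+1)\<^sup>-\<^sup>s\<close> are \<open>y\<^sup>-\<^sup>s\<close> times a binomial series in \<open>x/y\<close>
  and \<open>1/y\<close>.  Constant and linear terms cancel in \<open>g\<^sub>n\<close>, so only second-order remainders survive.
\<close>
lemma zeta_difference_term_bound:
  assumes x: "x > 0"
  shows "\<exists>C. \<forall>\<^sub>F n in sequentially. \<forall>s. norm s \<le> R \<longrightarrow>
     norm (zeta_difference_term x n s) \<le> C * (real n + 1) powr (- 1 - 1 - Re s)"
proof -
  define E where "E w s = (1 + w) powr (- s) - (\<Sum>j<2. (- s gchoose j) * w ^ j)" for w s :: complex
  obtain C where C: "\<And>a w :: complex. norm a \<le> R \<Longrightarrow> norm w \<le> 1/2 \<Longrightarrow>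
     norm ((1 + w) powr a - (\<Sum>j<2. (a gchoose j) * w ^ j)) \<le> C * norm w ^ 2"
    using binomial_remainder_bound[of R 2] by blast
  have "\<forall>\<^sub>F n in sequentially. \<forall>s. norm s \<le> R \<longrightarrow>
     norm (zeta_difference_term x n s) \<le> C * (x\<^sup>2 + x) * (real n + 1) powr (- 1 - 1 - Re s)"
    \<comment> \<open>This makes both \<open>x/y\<close> and \<open>1/y\<close> at most \<open>1/2\<close>.\<close>
    using eventually_ge_at_top[of "nat \<lceil>2 + 2 * x\<rceil>"]
  proof (eventually_elim, intro allI impI)
    fix n :: nat and s :: complex
    assume n: "n \<ge> nat \<lceil>2 + 2 * x\<rceil>" and s: "norm s \<le> R"
    define y where "y = real n + 1"
    have y: "y \<ge> 2 + 2 * x" using n unfolding y_def by linarith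
    have E: "norm (E (of_real (t / y)) s) \<le> C * (t / y)\<^sup>2" if "t > 0" "2 * t \<le> y" for t :: real
      using C[of "- s" "of_real (t / y)"] that s y x
      by (simp add: E_def norm_divide field_simps del: of_real_divide)
    have shift: "complex_of_real (y + t) powr (- s) =
        of_real y powr (- s) * (1 - s * of_real (t / y) + E (of_real (t / y)) s)" if "t > 0" for t
      using of_real_add_powr[of y t "- s"] that y x
      by (simp add: E_def numeral_2_eq_2 del: of_real_divide of_real_add)
    have "zeta_difference_term x n s = of_real y powr (- s) *
        (E (of_real (x / y)) s - of_real x * E (of_real (1 / y)) s)"
    proof -
      have "real n + 2 = y + 1" by (simp add: y_def)
      then have "zeta_difference_term x n s = complex_of_real (y + x) powr (- s) - complex_of_real y powr (- s)
         - of_real x * (complex_of_real (y + 1) powr (- s) - complex_of_real y powr (- s))"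
        unfolding zeta_difference_term_def y_def by (simp only:)
      then show ?thesis
        unfolding shift[OF x] shift[OF zero_less_one] by (simp add: algebra_simps)
    qed
    then have "norm (zeta_difference_term x n s) = y powr (- Re s) *
        norm (E (of_real (x / y)) s - of_real x * E (of_real (1 / y)) s)"
      using y x by (simp add: norm_mult norm_of_real_powr)
    also have "\<dots> \<le> y powr (- Re s) * (C * (x / y)\<^sup>2 + x * (C * (1 / y)\<^sup>2))"
    proof (intro mult_left_mono order.trans[OF norm_triangle_ineq4] add_mono)
      show "norm (complex_of_real x * E (of_real (1 / y)) s) \<le> x * (C * (1 / y)\<^sup>2)"
        unfolding norm_mult using x y E[of 1] by (simp add: mult_left_mono del: of_real_divide)
    qed (use x y E[of x] in auto)
    also have "\<dots> = C * (x\<^sup>2 + x) * (y powr (- Re s) / y powr 2)"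
      using y x by (simp add: power_divide field_simps)
    also have "y powr (- Re s) / y powr 2 = y powr (- 1 - 1 - Re s)"
      unfolding powr_diff[symmetric] by (rule arg_cong[where f = "(powr) y"]) simp
    finally show "norm (zeta_difference_term x n s) \<le> C * (x\<^sup>2 + x) * (real n + 1) powr (- 1 - 1 - Re s)"
      unfolding y_def .
  qed
  then show ?thesis by blast
qed

lemma zeta_difference_sums:
  assumes x: "x > 0" and s: "Re s > 1"
  shows "(\<lambda>n. zeta_difference_term x n s) sums
     (hurwitz_series x s - of_real x powr (- s) - hurwitz_series 1 s + of_real x)"
proof -
  have x_series: "(\<lambda>n. complex_of_real (real (Suc n) + x) powr (- s)) sums
      (hurwitz_series x s - complex_of_real (real 0 + x) powr (- s))"
    using hurwitz_series_sums[OF x s] by (subst sums_Suc_iff) simp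
  have one_series: "(\<lambda>n. complex_of_real (real n + 1) powr (- s)) sums hurwitz_series 1 s"
    by (rule hurwitz_series_sums) (use s in auto)
  have telescope: "(\<lambda>n. complex_of_real (real (Suc n) + 1) powr (- s) - complex_of_real (real n + 1) powr (- s))
      sums (0 - complex_of_real (real 0 + 1) powr (- s))"
    using s by (intro telescope_sums shifted_powr_tendsto_0) auto
  have "(\<lambda>n. complex_of_real (real (Suc n) + x) powr (- s) - complex_of_real (real n + 1) powr (- s)
      - of_real x * (complex_of_real (real (Suc n) + 1) powr (- s) - complex_of_real (real n + 1) powr (- s)))
      sums (hurwitz_series x s - complex_of_real (real 0 + x) powr (- s) - hurwitz_series 1 s
        - of_real x * (0 - complex_of_real (real 0 + 1) powr (- s)))"
    by (rule sums_diff[OF sums_diff[OF x_series one_series] sums_mult[OF telescope]])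
  then show ?thesis
    by (simp add: zeta_difference_term_def add_ac)
qed

text \<open>
  Both sides are holomorphic on the half-plane \<open>Re s > -1\<close> without the point \<open>1\<close>, a connected set,
  and they agree for \<open>Re s > 1\<close>.
\<close>
lemma hurwitz_zeta_minus_riemann_zeta:
  assumes x: "x > 0" and s: "Re s > - 1" "s \<noteq> 1"
  shows "hurwitz_zeta s x - riemann_zeta s =
     of_real x powr (- s) - of_real x + (\<Sum>n. zeta_difference_term x n s)"
proof (rule analytic_continuation_open[of "{s. Re s > 1}" "{s. Re s > - 1} - {1}"
        "\<lambda>s. hurwitz_zeta s x - riemann_zeta s"
        "\<lambda>s. of_real x powr (- s) - of_real x + (\<Sum>n. zeta_difference_term x n s)"])
  show "open {s. Re s > 1}" "open ({s. Re s > - 1} - {1})"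
    by (auto intro!: open_Diff open_halfspace_Re_gt)
  have "(2 :: complex) \<in> {s. Re s > 1}" by simp
  then show "{s. Re s > 1} \<noteq> {}" by blast
  show "connected ({s. Re s > - 1} - {1})"
    by (intro connected_open_delete open_halfspace_Re_gt connected_halfspace_Re_gt) simp
  have zeta: "(\<lambda>s. hurwitz_zeta s y) holomorphic_on {s. Re s > - 1} - {1}" if "y > 0" for y
    using hurwitz_zeta_continuation[OF that] holomorphic_on_subset
    unfolding is_hurwitz_continuation_def by blast
  then show "(\<lambda>s. hurwitz_zeta s x - riemann_zeta s) holomorphic_on {s. Re s > - 1} - {1}"
    unfolding riemann_zeta_def using x by (intro holomorphic_intros) auto
  have "(\<lambda>s. \<Sum>n. zeta_difference_term x n s) holomorphic_on {s. Re s > - 1}"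
    by (rule holomorphic_on_half_plane_dominated_series[OF zero_less_one zeta_difference_term_bound[OF x]])
       (intro holomorphic_intros x)
  then have "(\<lambda>s. \<Sum>n. zeta_difference_term x n s) holomorphic_on {s. Re s > - 1} - {1}"
    by (rule holomorphic_on_subset) auto
  then show "(\<lambda>s. of_real x powr (- s) - of_real x + (\<Sum>n. zeta_difference_term x n s))
      holomorphic_on {s. Re s > - 1} - {1}"
    using x by (intro holomorphic_intros)
  show "hurwitz_zeta z x - riemann_zeta z =
      of_real x powr (- z) - of_real x + (\<Sum>n. zeta_difference_term x n z)" if "z \<in> {s. Re s > 1}" for z
    using that x sums_unique[OF zeta_difference_sums[OF x, of z], symmetric]
    by (simp add: riemann_zeta_def hurwitz_zeta_eq_series)
qed (use s in auto)

section \<open>Derivatives at the origin\<close>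

lemma higher_deriv_of_real_powr_uminus:
  fixes y :: real
  assumes "y > 0"
  shows "(deriv ^^ m) (\<lambda>s. complex_of_real y powr (- s)) = (\<lambda>s. of_real (- ln y) ^ m * of_real y powr (- s))"
proof (induction m)
  case (Suc m)
  have "((\<lambda>s. complex_of_real (- ln y) ^ m * of_real y powr (- s)) has_field_derivative
      of_real (- ln y) ^ Suc m * of_real y powr (- s)) (at s)" for s
    using assms
    by (auto intro!: derivative_eq_intros DERIV_chain2[OF has_field_derivative_powr_right] simp: Ln_of_real)
  then have "deriv (\<lambda>s. complex_of_real (- ln y) ^ m * of_real y powr (- s))
      = (\<lambda>s. of_real (- ln y) ^ Suc m * of_real y powr (- s))"
    by (intro ext DERIV_imp_deriv)
  then show ?case by (simp add: Suc)
qed simp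

lemma higher_deriv_of_real_powr_uminus_0:
  fixes y :: real
  assumes "y > 0"
  shows "(deriv ^^ m) (\<lambda>s. complex_of_real y powr (- s)) 0 = (- 1) ^ m * of_real (ln y ^ m)"
  using assms by (subst higher_deriv_of_real_powr_uminus) (simp_all add: power_minus[of "of_real (ln y)"])

lemma higher_deriv_zeta_difference_term:
  assumes "x > 0"
  shows "(deriv ^^ m) (zeta_difference_term x n) 0 = (- 1) ^ m *
     of_real (ln (real n + 1 + x) ^ m - ln (real n + 1) ^ m
       - x * (ln (real n + 2) ^ m - ln (real n + 1) ^ m))"
proof -
  have pos: "real n + 1 + x > 0" "real n + 1 > 0" "real n + 2 > 0"
    using assms by auto
  note D = higher_deriv_of_real_powr_uminus_0[where m = m]
  have "(deriv ^^ m) (zeta_difference_term x n) 0 =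
      (deriv ^^ m) (\<lambda>s. complex_of_real (real n + 1 + x) powr (- s)) 0
      - (deriv ^^ m) (\<lambda>s. complex_of_real (real n + 1) powr (- s)) 0
      - of_real x * ((deriv ^^ m) (\<lambda>s. complex_of_real (real n + 2) powr (- s)) 0
           - (deriv ^^ m) (\<lambda>s. complex_of_real (real n + 1) powr (- s)) 0)"
    unfolding zeta_difference_term_def[abs_def]
    using pos by (simp add: higher_deriv_diff[OF _ _ open_UNIV UNIV_I] higher_deriv_cmult[OF _ UNIV_I open_UNIV]
        holomorphic_intros del: of_real_add)
  then show ?thesis
    unfolding D[OF pos(1)] D[OF pos(2)] D[OF pos(3)] by (simp add: algebra_simps)
qed

lemma higher_deriv_sum_entire:
  fixes f :: "nat \<Rightarrow> complex \<Rightarrow> complex"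
  assumes "\<And>n. f n holomorphic_on UNIV"
  shows "(deriv ^^ m) (\<lambda>s. \<Sum>n<N. f n s) z = (\<Sum>n<N. (deriv ^^ m) (f n) z)"
proof (induction N)
  case (Suc N)
  have "(deriv ^^ m) (\<lambda>s. (\<Sum>n<N. f n s) + f N s) z
      = (deriv ^^ m) (\<lambda>s. \<Sum>n<N. f n s) z + (deriv ^^ m) (f N) z"
    by (rule higher_deriv_add[OF _ _ open_UNIV UNIV_I]) (intro holomorphic_intros assms)+
  then show ?case by (simp add: Suc)
qed simp

text \<open>
  Locally uniform convergence near \<open>0\<close> carries over to all derivatives, so the series for
  \<open>\<zeta>(s,x) - \<zeta>(s)\<close> may be differentiated termwise.  The hypothesis \<open>m > 0\<close> removes the constant
  \<open>x\<close> left by the telescoping part.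
\<close>
lemma higher_deriv_zeta_difference_sums:
  assumes x: "x > 0" and m: "m > 0"
  shows "(\<lambda>n. (deriv ^^ m) (zeta_difference_term x n) 0) sums
     ((deriv ^^ m) (\<lambda>s. hurwitz_zeta s x) 0 - (deriv ^^ m) riemann_zeta 0
       - (- 1) ^ m * of_real (ln x ^ m))"
proof -
  define S where "S s = (\<Sum>n. zeta_difference_term x n s)" for s
  let ?H = "{s. Re s > - 1} - {1 :: complex}"
  have "\<exists>d>0. cball 0 d \<subseteq> {s. Re s > - 1} \<and>
      uniform_limit (cball 0 d) (\<lambda>N s. \<Sum>n<N. zeta_difference_term x n s) S sequentially"
    unfolding S_def[abs_def]
    by (rule half_plane_dominated_series[OF zero_less_one zeta_difference_term_bound[OF x]]) simp
  then obtain d where d: "d > 0"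
    and lim: "uniform_limit (cball 0 d) (\<lambda>N s. \<Sum>n<N. zeta_difference_term x n s) S sequentially"
    by blast
  have "(\<lambda>N. (deriv ^^ m) (\<lambda>s. \<Sum>n<N. zeta_difference_term x n s) 0) \<longlonglongrightarrow> (deriv ^^ m) S 0"
  proof (rule higher_deriv_complex_uniform_limit)
    show "uniform_limit (ball 0 d) (\<lambda>N s. \<Sum>n<N. zeta_difference_term x n s) S sequentially"
      using lim by (rule uniform_limit_on_subset) auto
    show "\<forall>\<^sub>F N in sequentially. (\<lambda>s. \<Sum>n<N. zeta_difference_term x n s) holomorphic_on ball 0 d"
      by (intro always_eventually allI holomorphic_intros x)
  qed (use d in auto)
  then have sums: "(\<lambda>n. (deriv ^^ m) (zeta_difference_term x n) 0) sums (deriv ^^ m) S 0"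
    unfolding sums_def by (subst (asm) higher_deriv_sum_entire) (intro holomorphic_intros x)
  have open_H: "open ?H" and zero: "0 \<in> ?H"
    by (auto intro!: open_Diff open_halfspace_Re_gt)
  have zeta: "(\<lambda>s. hurwitz_zeta s y) holomorphic_on ?H" if "y > 0" for y
    using hurwitz_zeta_continuation[OF that] holomorphic_on_subset
    unfolding is_hurwitz_continuation_def by blast
  have rzeta: "riemann_zeta holomorphic_on ?H"
    unfolding riemann_zeta_def[abs_def] by (rule zeta) simp
  have pow: "(\<lambda>s. complex_of_real x powr (- s) - of_real x) holomorphic_on ?H"
    using x by (intro holomorphic_intros)
  have "(deriv ^^ m) S 0 = (deriv ^^ m) (\<lambda>s. (hurwitz_zeta s x - riemann_zeta s)
      - (of_real x powr (- s) - of_real x)) 0"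
  proof (rule higher_deriv_cong_ev[OF _ refl])
    show "\<forall>\<^sub>F s in nhds 0. S s = (hurwitz_zeta s x - riemann_zeta s) - (of_real x powr (- s) - of_real x)"
      using eventually_nhds_in_open[OF open_H zero]
      by eventually_elim (use hurwitz_zeta_minus_riemann_zeta[OF x] in \<open>auto simp: S_def\<close>)
  qed
  also have "\<dots> = (deriv ^^ m) (\<lambda>s. hurwitz_zeta s x - riemann_zeta s) 0
      - (deriv ^^ m) (\<lambda>s. of_real x powr (- s) - of_real x) 0"
    by (intro higher_deriv_diff[OF _ _ open_H zero] holomorphic_intros zeta rzeta pow x)
  also have "(deriv ^^ m) (\<lambda>s. hurwitz_zeta s x - riemann_zeta s) 0
      = (deriv ^^ m) (\<lambda>s. hurwitz_zeta s x) 0 - (deriv ^^ m) riemann_zeta 0"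
    by (intro higher_deriv_diff[OF _ _ open_H zero] zeta rzeta x)
  also have "(deriv ^^ m) (\<lambda>s. complex_of_real x powr (- s) - of_real x) 0
      = (- 1) ^ m * of_real (ln x ^ m)"
    using m x
    by (subst higher_deriv_diff[OF _ _ open_UNIV UNIV_I])
       (auto intro!: holomorphic_intros simp: higher_deriv_of_real_powr_uminus_0)
  finally show ?thesis using sums by simp
qed

theorem proposition5p3:
  fixes k :: nat and x :: real
  assumes "x > 0"
  shows
    "(summable (\<lambda>n::nat. ln (real n + 1 + x) ^ (k + 1) - ln (real n + 1) ^ (k + 1)
          - x * (ln (real n + 2) ^ (k + 1) - ln (real n + 1) ^ (k + 1))) \<and>
      (- 1) ^ (k + 1) * ((deriv ^^ (k + 1)) (\<lambda>s. hurwitz_zeta s x) 0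
                          - (deriv ^^ (k + 1)) riemann_zeta 0)
        = complex_of_real (ln x ^ (k + 1)
          + (\<Sum>n::nat. ln (real n + 1 + x) ^ (k + 1) - ln (real n + 1) ^ (k + 1)
               - x * (ln (real n + 2) ^ (k + 1) - ln (real n + 1) ^ (k + 1))))) \<and>
     ((\<lambda>N::nat. complex_of_real (ln x ^ (k + 1)
          + (\<Sum>n = 1..N. ln (real n + x) ^ (k + 1) - ln (real n) ^ (k + 1)
               - x * (ln (real n + 1) ^ (k + 1) - ln (real n) ^ (k + 1)))))
        \<longlonglongrightarrow> (- 1) ^ (k + 1) * ((deriv ^^ (k + 1)) (\<lambda>s. hurwitz_zeta s x) 0
                          - (deriv ^^ (k + 1)) riemann_zeta 0))"
proof -
  define m where "m = k + 1"
  define t where "t n = ln (real n + 1 + x) ^ m - ln (real n + 1) ^ m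
      - x * (ln (real n + 2) ^ m - ln (real n + 1) ^ m)" for n
  define L where "L = (- 1) ^ m * ((deriv ^^ m) (\<lambda>s. hurwitz_zeta s x) 0 - (deriv ^^ m) riemann_zeta 0)"
  have sign: "(- 1) ^ m * ((- 1) ^ m * z) = z" for z :: complex
    by (simp flip: mult.assoc power_mult_distrib)
  have "(\<lambda>n. (- 1) ^ m * (deriv ^^ m) (zeta_difference_term x n) 0) sums
      ((- 1) ^ m * ((deriv ^^ m) (\<lambda>s. hurwitz_zeta s x) 0 - (deriv ^^ m) riemann_zeta 0
       - (- 1) ^ m * of_real (ln x ^ m)))"
    by (intro sums_mult higher_deriv_zeta_difference_sums assms) (simp add: m_def)
  then have sums: "(\<lambda>n. complex_of_real (t n)) sums (L - of_real (ln x ^ m))"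
    unfolding higher_deriv_zeta_difference_term[OF assms] t_def[symmetric] sign
      right_diff_distrib[of "(- 1) ^ m"] L_def .
  have "summable t"
    using sums by (simp add: sums_iff summable_complex_of_real)
  then have "(\<lambda>n. complex_of_real (t n)) sums of_real (suminf t)"
    by (simp add: sums_of_real summable_sums)
  then have L_eq: "L = of_real (ln x ^ m + suminf t)"
    using sums_unique2[OF sums] by (simp add: algebra_simps)
  have "(\<Sum>n = 1..N. ln (real n + x) ^ m - ln (real n) ^ m - x * (ln (real n + 1) ^ m - ln (real n) ^ m))
      = (\<Sum>n<N. t n)" for N
    by (rule sum.reindex_bij_witness[of _ Suc "\<lambda>n. n - 1"]) (auto simp: t_def add_ac of_nat_diff)
  moreover have "(\<lambda>N. complex_of_real (ln x ^ m + (\<Sum>n<N. t n))) \<longlonglongrightarrow> L"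
    unfolding L_eq using summable_LIMSEQ[OF \<open>summable t\<close>] by (intro tendsto_intros)
  ultimately show ?thesis
    using \<open>summable t\<close> L_eq unfolding t_def L_def m_def by simp
qed

end
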